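(* Consider the separable convex problem described in the context and assume that a dual maximizer $\lambda^*\in\mathbb{R}^m_+$ exists and that strong duality holds. Run the stochastic dual subgradient algorithm described in the context for $T$ iterations with input $\lambda_0=0_m$ and constant stepsize $\alpha_t=\alpha=\frac{\Lambda}{\tilde G\sqrt T}$ for some $\Lambda>0$. Then the primal output $\bar x_T=(\bar x_{1,T},\dots,\bar x_{N,T})$ satisfies $$\mathbb{E}_1\Big[\Big\|\frac1N\sum_{i=1}^NA_i\bar x_{i,T}-b\Big\|_+\Big]\le\tilde G\sqrt{\frac{N-1}{T}}+\frac{2\tilde G\|\lambda^*\|}{\Lambda\sqrt T}+\frac{\tilde G}{\sqrt T}+\frac{N\tilde G}{T}$$ and $$\mathbb{E}_1\Big[\frac1N\sum_{i=1}^Nh_i(\bar x_{i,T})\Big]\le d^*+H\sqrt{\frac{N-1}{T}}+\frac{\Lambda\tilde G}{2\sqrt T}+\frac{N\tilde G(2\|\lambda^*\|+\Lambda)}{T}.$$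
   Context: Problem. For $i=1,\dots,N$, $h_i:\mathbb{R}^{d_i}\to\mathbb{R}\cup\{+\infty\}$ is proper, convex, lower semicontinuous with convex compact domain $X_i=\mathrm{dom}(h_i)$; $A_i\in\mathbb{R}^{m\times d_i}$, $b\in\mathbb{R}^m$. The primal problem is to minimize $\frac1N\sum_i h_i(x_i)$ subject to $\frac1N\sum_i A_ix_i\le b$ (componentwise), $x_i\in X_i$. The dual function is $d(\lambda)=-\lambda^\top b+\frac1N\sum_{i=1}^N\inf_{x_i\in X_i}\{h_i(x_i)+\lambda^\top A_ix_i\}$, maximized over $\lambda\in\mathbb{R}^m_+$. Standing assumption: there is $\lambda^*\in\arg\max_{\lambda\in\mathbb{R}^m_+}d(\lambda)$, and $d^*:=d(\lambda^* )$ equals the optimal value of the primal problem (strong duality). Notation. $\|\cdot\|$ is the Euclidean norm, $\|x\|_+=\sqrt{\sum_j\max(x_j,0)^2}$, $\Pi_+(x)_j=\max(x_j,0)$. $\tilde G=\sup_{i,\,x_i\in X_i}\|A_ix_i-b\|$ (assumed positive), $H=\sup_{i,\,x_i\in X_i}|h_i(x_i)|$ (treated as a finite constant). Oracle. $x_i^*(\lambda)\in\arg\min_{x_i\in X_i}\{h_i(x_i)+\lambda^\top A_ix_i\}$ is a fixed selection. Stochastic dual subgradient algorithm ($T\ge1$ iterations). Start from $\lambda_0$. For $t=0,\dots,T-2$: sample $i_t$ uniformly in $\{1,\dots,N\}$ (independently of the past), set $g_t=A_{i_t}x^*_{i_t}(\lambda_t)-b$ and $\lambda_{t+1}=\Pi_+(\lambda_t+\alpha_tg_t)$.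 Let $I_i$ be the number of $t\in\{0,\dots,T-2\}$ with $i_t=i$. Last step ($t=T-1$): compute $x_i^*(\lambda_{T-1})$ for all $i$, set $g_{T-1}=\frac1N\sum_iA_ix_i^*(\lambda_{T-1})-b$, $\lambda_T=\Pi_+(\lambda_{T-1}+\alpha_{T-1}g_{T-1})$. Output $\bar\lambda_T=\frac1T\sum_{t=0}^{T-1}\lambda_t$ and $$\bar x_{i,T}=\frac1{I_i+1}\Big(x_i^*(\lambda_{T-1})+\sum_{t\le T-2,\,i_t=i}x_i^*(\lambda_t)\Big),\quad i=1,\dots,N.$$ $\mathbb{E}_1$ is the expectation over the randomness of this algorithm. *)

theory Defs
  imports "HOL-Probability.Probability"
begin

section \<open>Extended-real-valued convex functions\<close>

definition eff_dom :: "('a \<Rightarrow> ereal) \<Rightarrow> 'a set" where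
  "eff_dom h = {x. h x < \<infinity>}"

definition proper_fun :: "('a \<Rightarrow> ereal) \<Rightarrow> bool" where
  "proper_fun h \<longleftrightarrow> (\<forall>x. h x \<noteq> -\<infinity>) \<and> (\<exists>x. h x \<noteq> \<infinity>)"

text \<open>The library's \<^const>\<open>convex_on\<close> is restricted to real-valued functions. For functions that
  never take the value \<open>-\<infinity>\<close> no undefined sum occurs below; recall that \<open>0 * \<infinity> = 0\<close> in
  \<^typ>\<open>ereal\<close>.\<close>

definition ereal_convex :: "('a::real_vector \<Rightarrow> ereal) \<Rightarrow> bool" where
  "ereal_convex h \<longleftrightarrow>
     (\<forall>x y. \<forall>t\<in>{0..1::real}.
        h ((1 - t) *\<^sub>R x + t *\<^sub>R y) \<le> ereal (1 - t) * h x + ereal t * h y)"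

definition lower_semicont :: "('a::topological_space \<Rightarrow> ereal) \<Rightarrow> bool" where
  "lower_semicont h \<longleftrightarrow> (\<forall>x. h x \<le> Liminf (at x) h)"

section \<open>Positive part\<close>

definition pos_proj :: "real ^ 'm \<Rightarrow> real ^ 'm" where
  "pos_proj x = (\<chi> j. max (x $ j) 0)"

definition pos_norm :: "real ^ 'm \<Rightarrow> real" where
  "pos_norm x = sqrt (\<Sum>j\<in>UNIV. (max (x $ j) 0)\<^sup>2)"

section \<open>The separable problem and its dual\<close>

text \<open>The blocks are indexed by \<open>{1..N}\<close> and may have different dimensions. The space of the
  \<open>i\<close>-th block, of dimension \<open>d\<^sub>i = card (J i)\<close>, is the coordinate subspace \<open>block_space (J i)\<close> of
  a common \<^typ>\<open>real ^ 'd\<close>. As every dimension sequence of finite length is bounded and the sets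
  \<open>J i\<close> are arbitrary, all families of dimensions are covered. A function on block \<open>i\<close> is
  extended by \<open>\<infinity>\<close> outside the (closed) subspace, which changes neither properness, convexity, lower
  semicontinuity nor the domain; of the matrix \<open>A i\<close> only the columns in \<open>J i\<close> matter.\<close>

definition block_space :: "'d set \<Rightarrow> (real ^ 'd) set" where
  "block_space K = {x. \<forall>k. k \<notin> K \<longrightarrow> x $ k = 0}"

text \<open>The order on \<^typ>\<open>real ^ 'm\<close> is componentwise.\<close>

definition primal_value ::
  "nat \<Rightarrow> (nat \<Rightarrow> real ^ 'd \<Rightarrow> ereal) \<Rightarrow> (nat \<Rightarrow> real ^ 'd ^ 'm) \<Rightarrow> real ^ 'm \<Rightarrow> ereal" where
  "primal_value N h A b =
     (INF x\<in>{x :: nat \<Rightarrow> real ^ 'd. (\<forall>i\<in>{1..N}. x i \<in> eff_dom (h i)) \<and>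
               (1 / real N) *\<^sub>R (\<Sum>i\<in>{1..N}. A i *v x i) \<le> b}.
        ereal (1 / real N) * (\<Sum>i\<in>{1..N}. h i (x i)))"

definition dual_fun ::
  "nat \<Rightarrow> (nat \<Rightarrow> real ^ 'd \<Rightarrow> ereal) \<Rightarrow> (nat \<Rightarrow> real ^ 'd ^ 'm) \<Rightarrow> real ^ 'm \<Rightarrow> real ^ 'm \<Rightarrow> ereal" where
  "dual_fun N h A b l =
     ereal (- (l \<bullet> b)) +
     ereal (1 / real N) *
       (\<Sum>i\<in>{1..N}. INF x\<in>eff_dom (h i). h i x + ereal (l \<bullet> (A i *v x)))"

text \<open>An oracle selects one minimizer of each block Lagrangian. It is only ever queried at
  multipliers in the nonnegative orthant.\<close>

definition is_oracle ::
  "nat \<Rightarrow> (nat \<Rightarrow> real ^ 'd \<Rightarrow> ereal) \<Rightarrow> (nat \<Rightarrow> real ^ 'd ^ 'm) \<Rightarrow>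
   (nat \<Rightarrow> real ^ 'm \<Rightarrow> real ^ 'd) \<Rightarrow> bool" where
  "is_oracle N h A xs \<longleftrightarrow>
     (\<forall>i\<in>{1..N}. \<forall>l. 0 \<le> l \<longrightarrow>
        is_arg_min (\<lambda>x. h i x + ereal (l \<bullet> (A i *v x))) (\<lambda>x. x \<in> eff_dom (h i)) (xs i l))"

section \<open>The stochastic dual subgradient algorithm\<close>

text \<open>The argument \<open>s\<close> is the realized sequence of sampled indices; only \<open>s t\<close> with \<open>t < T - 1\<close>
  is used. For \<open>t = T - 1\<close> the full subgradient replaces the sampled one.\<close>

definition step_dir ::
  "nat \<Rightarrow> (nat \<Rightarrow> real ^ 'd ^ 'm) \<Rightarrow> real ^ 'm \<Rightarrow> (nat \<Rightarrow> real ^ 'm \<Rightarrow> real ^ 'd) \<Rightarrow> nat \<Rightarrow>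
   (nat \<Rightarrow> nat) \<Rightarrow> nat \<Rightarrow> real ^ 'm \<Rightarrow> real ^ 'm" where
  "step_dir N A b xs T s t l =
     (if t < T - 1 then A (s t) *v xs (s t) l - b
      else (1 / real N) *\<^sub>R (\<Sum>i\<in>{1..N}. A i *v xs i l) - b)"

primrec dual_iter ::
  "nat \<Rightarrow> (nat \<Rightarrow> real ^ 'd ^ 'm) \<Rightarrow> real ^ 'm \<Rightarrow> (nat \<Rightarrow> real ^ 'm \<Rightarrow> real ^ 'd) \<Rightarrow> nat \<Rightarrow>
   (nat \<Rightarrow> real) \<Rightarrow> real ^ 'm \<Rightarrow> (nat \<Rightarrow> nat) \<Rightarrow> nat \<Rightarrow> real ^ 'm" where
  "dual_iter N A b xs T \<alpha> l0 s 0 = l0"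
| "dual_iter N A b xs T \<alpha> l0 s (Suc t) =
     pos_proj (dual_iter N A b xs T \<alpha> l0 s t +
               \<alpha> t *\<^sub>R step_dir N A b xs T s t (dual_iter N A b xs T \<alpha> l0 s t))"

definition visits :: "nat \<Rightarrow> (nat \<Rightarrow> nat) \<Rightarrow> nat \<Rightarrow> nat set" where
  "visits T s i = {t. t < T - 1 \<and> s t = i}"

definition primal_output ::
  "nat \<Rightarrow> (nat \<Rightarrow> real ^ 'd ^ 'm) \<Rightarrow> real ^ 'm \<Rightarrow> (nat \<Rightarrow> real ^ 'm \<Rightarrow> real ^ 'd) \<Rightarrow> nat \<Rightarrow>
   (nat \<Rightarrow> real) \<Rightarrow> real ^ 'm \<Rightarrow> (nat \<Rightarrow> nat) \<Rightarrow> nat \<Rightarrow> real ^ 'd" where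
  "primal_output N A b xs T \<alpha> l0 s i =
     (1 / (real (card (visits T s i)) + 1)) *\<^sub>R
       (xs i (dual_iter N A b xs T \<alpha> l0 s (T - 1)) +
        (\<Sum>t\<in>visits T s i. xs i (dual_iter N A b xs T \<alpha> l0 s t)))"

text \<open>The sampled indices \<open>i\<^sub>0, \<dots>, i\<^sub>T\<^sub>-\<^sub>2\<close> are independent and uniform on \<open>{1..N}\<close>.\<close>

definition uniform_samples :: "'w measure \<Rightarrow> nat \<Rightarrow> nat \<Rightarrow> (nat \<Rightarrow> 'w \<Rightarrow> nat) \<Rightarrow> bool" where
  "uniform_samples M N T ix \<longleftrightarrow>
     prob_space M \<and>
     prob_space.indep_vars M (\<lambda>_. count_space {1..N}) ix {..<T - 1} \<and>
     (\<forall>t<T - 1. distr M (count_space {1..N}) (ix t) = uniform_count_measure {1..N})"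

end

(* The multipliers perform a stochastic projected subgradient ascent on the dual function. The
   squared distance to lstar has nonpositive mean drift up to the usual quadratic stepsize term, so
   E |lambda_t| <= 2 |lstar| + Lambda, and the multipliers dominate the accumulated residuals.

   The ergodic block averages are compared with the trajectory by weighting block i with
   (I_i + 1) / (T + N - 1) instead of 1 / N. The total of these weighted averages is the trajectory sum
   plus N - 1 further copies of the last full step, and the total error of the weights has mean at
   most sqrt ((N - 1) / T) by the variance of the binomial counts I_i. The total cost along the
   trajectory is controlled by the Lagrangian identity cost = dual value - <lambda, residual> and by
   the drift of |lambda|^2.

   All random quantities are functions of the finitely many samples, so the expectation is a finite
   average over {1..N}^(T-1), and conditioning on the past becomes resampling of one coordinate. *)
theory Submission
  imports Defs
begin

section \<open>Uniform averages over finite product spaces\<close>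

text \<open>On an empty or infinite \<open>S\<close> the conventions for \<open>sum\<close>,
  \<open>card\<close> and division give 0, so linearity and monotonicity hold for every
  \<open>S\<close>.\<close>

definition mean :: "'a set \<Rightarrow> ('a \<Rightarrow> real) \<Rightarrow> real" where
  "mean S f = sum f S / real (card S)"

lemma mean_cong: "(\<And>s. s \<in> S \<Longrightarrow> f s = g s) \<Longrightarrow> mean S f = mean S g"
  by (simp add: mean_def)

lemma mean_add: "mean S (\<lambda>s. f s + g s) = mean S f + mean S g"
  by (simp add: mean_def sum.distrib add_divide_distrib)

lemma mean_cmult: "mean S (\<lambda>s. c * f s) = c * mean S f"
  by (simp add: mean_def sum_distrib_left)

lemma mean_sum: "mean S (\<lambda>s. \<Sum>i\<in>I. f i s) = (\<Sum>i\<in>I. mean S (f i))"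
  unfolding mean_def sum_divide_distrib by (rule sum.swap)

lemma mean_mono: "(\<And>s. s \<in> S \<Longrightarrow> f s \<le> g s) \<Longrightarrow> mean S f \<le> mean S g"
  by (simp add: mean_def divide_right_mono sum_mono)

lemma mean_const: "finite S \<Longrightarrow> S \<noteq> {} \<Longrightarrow> mean S (\<lambda>_. c) = c"
  by (simp add: mean_def)

text \<open>Jensen for the square, here from Cauchy-Schwarz; for \<open>card S = 0\<close> both
  sides vanish.\<close>

lemma mean_le_sqrt_mean_square: "mean S f \<le> sqrt (mean S (\<lambda>s. (f s)\<^sup>2))"
proof (cases "card S = 0")
  case False
  have "(mean S f)\<^sup>2 \<le> mean S (\<lambda>s. (f s)\<^sup>2)"
    using sum_squared_le_sum_of_squares[of f S] False
    by (simp add: mean_def power2_eq_square divide_simps)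
  then show ?thesis
    by (simp add: real_le_rsqrt)
qed (simp add: mean_def)

text \<open>The finite form of conditioning on all coordinates but \<open>t\<close>: as
  \<open>F s\<close> does not look at \<open>s t\<close>, that coordinate acts as a fresh uniform
  sample.\<close>

lemma mean_resample_coordinate:
  assumes "finite I" "finite B" "B \<noteq> {}" "t \<in> I"
    and indep: "\<And>s i j. s \<in> I \<rightarrow>\<^sub>E B \<Longrightarrow> i \<in> B \<Longrightarrow> j \<in> B \<Longrightarrow> F (s(t := i)) j = F s j"
  shows "mean (I \<rightarrow>\<^sub>E B) (\<lambda>s. F s (s t)) = mean (I \<rightarrow>\<^sub>E B) (\<lambda>s. mean B (F s))"
proof -
  let ?S = "I \<rightarrow>\<^sub>E B"
  \<comment> \<open>Exchanging the coordinate \<open>t\<close> with the fresh sample is an involution of \<open>?S \<times> B\<close>.\<close>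
  have "(\<Sum>(s, i)\<in>?S \<times> B. F s i) = (\<Sum>(s, i)\<in>?S \<times> B. F s (s t))"
    by (rule sum.reindex_bij_witness[where i = "\<lambda>(s, i). (s(t := i), s t)"
          and j = "\<lambda>(s, i). (s(t := i), s t)"])
      (use \<open>t \<in> I\<close> in \<open>auto simp: indep PiE_iff extensional_def\<close>)
  then have "(\<Sum>s\<in>?S. sum (F s) B) = (\<Sum>s\<in>?S. F s (s t)) * card B"
    by (simp add: sum.cartesian_product[symmetric] sum_distrib_left mult.commute)
  then show ?thesis
    using assms(2,3) by (simp add: mean_def sum_divide_distrib[symmetric] divide_simps)
qed

text \<open>The binomial variance: the centred count is a sum of centred indicators
  \<open>e (s t)\<close>, which are pairwise uncorrelated and have variance
  \<open>p * (1 - p)\<close>.\<close>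

lemma mean_square_count_deviation:
  assumes "finite I" "finite B" "i \<in> B"
  defines "p \<equiv> 1 / real (card B)"
  shows "mean (I \<rightarrow>\<^sub>E B) (\<lambda>s. (real (card {t \<in> I. s t = i}) - p * real (card I))\<^sup>2) = real (card I) * (p * (1 - p))"
proof -
  let ?S = "I \<rightarrow>\<^sub>E B"
  define e where "e = (\<lambda>j. of_bool (j = i) - p)"
  have "B \<noteq> {}" and card_pos: "card B > 0"
    using assms card_gt_0_iff by auto
  have "finite ?S" and "?S \<noteq> {}"
    using assms \<open>B \<noteq> {}\<close> by (auto simp: finite_PiE PiE_eq_empty_iff)
  have mean_e: "mean B e = 0"
    using assms(2,3) card_pos
    by (simp add: mean_def e_def sum_subtractf p_def of_bool_def sum.delta)
  \<comment> \<open>An indicator equals its own square, so the squared deviation is affine in it and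
    its mean follows from that of the indicator.\<close>
  have "(e j)\<^sup>2 = (1 - 2 * p) * of_bool (j = i) + p\<^sup>2" for j
    by (auto simp: e_def power2_eq_square algebra_simps)
  then have "mean B (\<lambda>j. (e j)\<^sup>2) = (1 - 2 * p) * p + p\<^sup>2"
    using assms(2,3) \<open>B \<noteq> {}\<close>
    by (simp add: mean_add mean_cmult mean_const) (simp add: mean_def p_def of_bool_def sum.delta)
  then have mean_e2: "mean B (\<lambda>j. (e j)\<^sup>2) = p * (1 - p)"
    by (simp add: power2_eq_square algebra_simps)
  \<comment> \<open>On the diagonal, resampling \<open>t\<close> leaves the variance of one sample.
    Off the diagonal it leaves \<open>s u\<close> fixed and averages \<open>e\<close> to 0.\<close>
  have cov: "mean ?S (\<lambda>s. e (s t) * e (s u)) = (if t = u then p * (1 - p) else 0)"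
    if "t \<in> I" "u \<in> I" for t u
  proof (cases "t = u")
    case True
    then have "mean ?S (\<lambda>s. e (s t) * e (s u)) = mean ?S (\<lambda>s. mean B (\<lambda>j. (e j)\<^sup>2))"
      using mean_resample_coordinate[of I B t "\<lambda>s j. (e j)\<^sup>2"] assms(1,2) \<open>B \<noteq> {}\<close> that
      by (simp add: power2_eq_square)
    then show ?thesis
      using True \<open>finite ?S\<close> \<open>?S \<noteq> {}\<close> by (simp add: mean_e2 mean_const)
  next
    case False
    then have "mean ?S (\<lambda>s. e (s t) * e (s u)) = mean ?S (\<lambda>s. mean B (\<lambda>j. e (s u) * e j))"
      using mean_resample_coordinate[of I B t "\<lambda>s j. e (s u) * e j"] assms(1,2) \<open>B \<noteq> {}\<close> that
      by (simp add: mult.commute)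
    then show ?thesis
      using False by (simp add: mean_cmult mean_e) (simp add: mean_def)
  qed
  have "real (card {t \<in> I. s t = i}) - p * real (card I) = (\<Sum>t\<in>I. e (s t))" for s
    using assms(1) by (simp add: e_def sum_subtractf sum_of_bool_eq Int_def mult.commute)
  then have "mean ?S (\<lambda>s. (real (card {t \<in> I. s t = i}) - p * real (card I))\<^sup>2)
      = (\<Sum>t\<in>I. \<Sum>u\<in>I. mean ?S (\<lambda>s. e (s t) * e (s u)))"
    by (simp add: power2_eq_square sum_product mean_sum)
  also have "\<dots> = real (card I) * (p * (1 - p))"
    using assms(1) by (simp add: cov sum.delta cong: sum.cong)
  finally show ?thesis .
qed

text \<open>Each of the \<open>N\<close> deviations has mean at most the standard deviation sqrt(n
  (N - 1)) / N of its count, where n = \<open>card I\<close>; summing cancels the factor 1 /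
  N.\<close>

lemma mean_sum_count_deviation:
  assumes "finite I" "finite B" "B \<noteq> {}"
  shows "mean (I \<rightarrow>\<^sub>E B) (\<lambda>s. \<Sum>i\<in>B. \<bar>card I / card B - card {t \<in> I. s t = i}\<bar>)
    \<le> sqrt (card I * (real (card B) - 1))"
proof -
  let ?S = "I \<rightarrow>\<^sub>E B"
  define N where "N = real (card B)"
  have N: "N \<ge> 1"
    using assms card_gt_0_iff[of B] by (simp add: N_def Suc_le_eq)
  have "mean ?S (\<lambda>s. \<bar>card I / N - card {t \<in> I. s t = i}\<bar>) \<le> sqrt (card I * (1 / N * (1 - 1 / N)))"
    if "i \<in> B" for i
    using mean_le_sqrt_mean_square[of ?S "\<lambda>s. \<bar>card I / N - card {t \<in> I. s t = i}\<bar>"]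
      mean_square_count_deviation[OF assms(1,2) that]
    by (simp add: N_def power2_commute[of "card I / card B" for I B])
  then have "mean ?S (\<lambda>s. \<Sum>i\<in>B. \<bar>card I / N - card {t \<in> I. s t = i}\<bar>)
      \<le> (\<Sum>i\<in>B. sqrt (card I * (1 / N * (1 - 1 / N))))"
    unfolding mean_sum by (intro sum_mono) auto
  also have "\<dots> = N * sqrt (card I * (1 / N * (1 - 1 / N)))"
    by (simp add: N_def)
  also have "\<dots> = sqrt (N\<^sup>2 * (card I * (1 / N * (1 - 1 / N))))"
    using N by (subst real_sqrt_mult) simp
  also have "N\<^sup>2 * (card I * (1 / N * (1 - 1 / N))) = card I * (N - 1)"
    using N by (simp add: power2_eq_square field_simps)
  finally show ?thesis
    by (simp add: N_def)
qed

text \<open>By \<open>dep\<close> the integrand is constant on each cylinder \<open>E s\<close>,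
  hence a simple function on finitely many events; independence gives each of them the same
  probability.\<close>

lemma integral_uniform_samples:
  fixes f :: "(nat \<Rightarrow> nat) \<Rightarrow> real"
  assumes samples: "uniform_samples M N T ix" and "N \<ge> 1"
    and dep: "\<And>s s'. (\<And>t. t < T - 1 \<Longrightarrow> s t = s' t) \<Longrightarrow> f s = f s'"
  shows "(\<integral>\<omega>. f (\<lambda>t. ix t \<omega>) \<partial>M) = mean ({..<T - 1} \<rightarrow>\<^sub>E {1..N}) f"
proof -
  let ?S = "{..<T - 1} \<rightarrow>\<^sub>E {1..N}"
  interpret prob_space M
    using samples by (simp add: uniform_samples_def)
  have indep: "indep_vars (\<lambda>_. count_space {1..N}) ix {..<T - 1}"
    and distr: "\<And>t. t < T - 1 \<Longrightarrow> distr M (count_space {1..N}) (ix t) = uniform_count_measure {1..N}"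
    using samples by (auto simp: uniform_samples_def)
  have meas: "ix t \<in> measurable M (count_space {1..N})" if "t < T - 1" for t
    using indep that by (auto simp: indep_vars_def)
  have coord: "prob (ix t -` {k} \<inter> space M) = 1 / N" if "t < T - 1" "k \<in> {1..N}" for t k
  proof -
    have "prob (ix t -` {k} \<inter> space M) = measure (distr M (count_space {1..N}) (ix t)) {k}"
      using meas that by (simp add: measure_distr)
    then show ?thesis
      using distr[OF that(1)] that by (simp add: measure_uniform_count_measure)
  qed
  define E where "E s = {\<omega> \<in> space M. \<forall>t<T - 1. ix t \<omega> = s t}" for s
  \<comment> \<open>For \<open>T = 1\<close> an intersection over no indices would be
    \<open>UNIV\<close> instead of \<open>space M\<close>, so that case is split off below.\<close>
  have E_eq: "E s = (\<Inter>t\<in>{..<T - 1}. ix t -` {s t} \<inter> space M)" if "{..<T - 1} \<noteq> {}" for s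
    using that by (auto simp: E_def)
  have prob_E: "prob (E s) = (1 / N) ^ (T - 1)" if "s \<in> ?S" for s
  proof (cases "T - 1 = 0")
    case True
    then show ?thesis
      by (simp add: E_def prob_space)
  next
    case False
    then have "{..<T - 1} \<noteq> {}"
      by (metis empty_iff lessThan_iff neq0_conv)
    then have "prob (E s) = (\<Prod>t<T - 1. prob (ix t -` {s t} \<inter> space M))"
      using that unfolding E_eq[OF \<open>{..<T - 1} \<noteq> {}\<close>]
      by (intro indep_varsD[OF indep]) (auto simp: PiE_iff)
    also have "\<dots> = (\<Prod>t<T - 1. 1 / N)"
      by (intro prod.cong) (use that in \<open>auto simp: coord PiE_iff\<close>)
    finally show ?thesis
      by simp
  qed
  have E_sets: "E s \<in> events" if "s \<in> ?S" for s
  proof (cases "T - 1 = 0")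
    case False
    then have "{..<T - 1} \<noteq> {}"
      by (metis empty_iff lessThan_iff neq0_conv)
    then show ?thesis
      using that unfolding E_eq[OF \<open>{..<T - 1} \<noteq> {}\<close>]
      by (intro sets.finite_INT measurable_sets[OF meas]) (auto simp: PiE_iff)
  qed (simp add: E_def)
  have "finite ?S"
    by (simp add: finite_PiE)
  have "(\<integral>\<omega>. f (\<lambda>t. ix t \<omega>) \<partial>M) = (\<integral>\<omega>. (\<Sum>s\<in>?S. f s * indicator (E s) \<omega>) \<partial>M)"
  proof (rule Bochner_Integration.integral_cong[OF refl])
    fix \<omega> assume \<omega>: "\<omega> \<in> space M"
    \<comment> \<open>The observed path, cut off so as to lie in the extensional product; its
      cylinder is the only one containing \<open>\<omega>\<close>, and \<open>dep\<close> undoes the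
      cut.\<close>
    define s0 where "s0 = restrict (\<lambda>t. ix t \<omega>) {..<T - 1}"
    have "s0 \<in> ?S"
      using measurable_space[OF meas \<omega>] by (auto simp: s0_def)
    have "\<omega> \<in> E s \<longleftrightarrow> s = s0" if "s \<in> ?S" for s
    proof
      assume "\<omega> \<in> E s"
      then show "s = s0"
        by (intro PiE_ext[OF that \<open>s0 \<in> ?S\<close>]) (simp add: E_def s0_def)
    qed (use \<omega> in \<open>simp add: E_def s0_def\<close>)
    then have "(\<Sum>s\<in>?S. f s * indicator (E s) \<omega>) = (\<Sum>s\<in>?S. if s = s0 then f s else 0)"
      by (intro sum.cong) (auto simp: indicator_def)
    also have "\<dots> = f s0"
      using \<open>finite ?S\<close> \<open>s0 \<in> ?S\<close> by simp
    also have "\<dots> = f (\<lambda>t. ix t \<omega>)"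
      by (rule dep) (simp add: s0_def)
    finally show "f (\<lambda>t. ix t \<omega>) = (\<Sum>s\<in>?S. f s * indicator (E s) \<omega>)" ..
  qed
  also have "\<dots> = (\<Sum>s\<in>?S. \<integral>\<omega>. f s * indicator (E s) \<omega> \<partial>M)"
    by (rule Bochner_Integration.integral_sum) (use E_sets in \<open>auto simp: emeasure_eq_measure\<close>)
  also have "\<dots> = (\<Sum>s\<in>?S. f s * (1 / N) ^ (T - 1))"
    by (intro sum.cong) (use E_sets prob_E in auto)
  also have "\<dots> = mean ?S f"
    by (simp add: mean_def card_PiE sum_divide_distrib power_one_over)
  finally show ?thesis .
qed

section \<open>Positive part\<close>

lemma pos_norm_eq: "pos_norm x = norm (pos_proj x)"
  by (simp add: pos_norm_def pos_proj_def norm_vec_def L2_set_def)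

lemma pos_proj_nonneg: "0 \<le> pos_proj x"
  by (simp add: pos_proj_def less_eq_vec_def)

lemma pos_norm_le_norm: "pos_norm x \<le> norm x"
  unfolding pos_norm_eq pos_proj_def
  by (rule norm_le_componentwise_cart) (simp add: max_def)

lemma pos_norm_mono:
  assumes "x \<le> y"
  shows "pos_norm x \<le> pos_norm y"
  unfolding pos_norm_eq
proof (rule norm_le_componentwise_cart)
  fix j
  have "x $ j \<le> y $ j"
    using assms by (simp add: less_eq_vec_def)
  then show "norm (pos_proj x $ j) \<le> norm (pos_proj y $ j)"
    by (simp add: pos_proj_def max_def)
qed

lemma pos_norm_triangle: "pos_norm (x + y) \<le> pos_norm x + pos_norm y"
proof -
  have "pos_norm (x + y) \<le> norm (pos_proj x + pos_proj y)"
    unfolding pos_norm_eq pos_proj_def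
    by (rule norm_le_componentwise_cart) (auto simp: max_def)
  also have "\<dots> \<le> pos_norm x + pos_norm y"
    unfolding pos_norm_eq by (rule norm_triangle_ineq)
  finally show ?thesis .
qed

lemma pos_norm_scaleR:
  assumes "c \<ge> 0"
  shows "pos_norm (c *\<^sub>R x) = c * pos_norm x"
proof -
  have "pos_proj (c *\<^sub>R x) = c *\<^sub>R pos_proj x"
    using assms by (simp add: pos_proj_def vec_eq_iff max_mult_distrib_left)
  then show ?thesis
    using assms by (simp add: pos_norm_eq)
qed

text \<open>Clipping moves only negative coordinates, and moves them toward the nonnegative
  \<open>y $ j\<close>.\<close>

lemma norm_pos_proj_diff_le:
  assumes "0 \<le> y"
  shows "norm (pos_proj x - y) \<le> norm (x - y)"
proof (rule norm_le_componentwise_cart)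
  fix j
  have "0 \<le> y $ j"
    using assms by (simp add: less_eq_vec_def)
  then show "norm ((pos_proj x - y) $ j) \<le> norm ((x - y) $ j)"
    by (auto simp: pos_proj_def max_def)
qed

section \<open>Averaged outputs\<close>

text \<open>The visit sets partition the sampled iterations, because the path takes all its values
  in \<open>{1..N}\<close>.\<close>

lemma sum_over_visits:
  fixes q :: "nat \<Rightarrow> nat \<Rightarrow> 'a::comm_monoid_add"
  assumes "s \<in> {..<T - 1} \<rightarrow>\<^sub>E {1..N}"
  shows "(\<Sum>i\<in>{1..N}. \<Sum>t\<in>visits T s i. q i t) = (\<Sum>t<T - 1. q (s t) t)"
proof -
  have "(\<Sum>t<T - 1. q (s t) t) = (\<Sum>i\<in>{1..N}. \<Sum>t\<in>{t \<in> {..<T - 1}. s t = i}. q (s t) t)"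
    by (rule sum.group[symmetric]) (use assms in auto)
  also have "\<dots> = (\<Sum>i\<in>{1..N}. \<Sum>t\<in>visits T s i. q i t)"
    by (intro sum.cong) (auto simp: visits_def)
  finally show ?thesis ..
qed

text \<open>Comparing the weights \<open>1 / N\<close> of the blocks with the sampling frequencies
  \<open>(I\<^sub>i + 1) / (T + N - 1)\<close>; the last iteration contributes one sample per block.\<close>

lemma average_of_visit_averages:
  fixes q :: "nat \<Rightarrow> nat \<Rightarrow> 'a::real_vector"
  assumes "N \<ge> 1" "T \<ge> 1" and s: "s \<in> {..<T - 1} \<rightarrow>\<^sub>E {1..N}"
    and v: "\<And>i. v i = (1 / (real (card (visits T s i)) + 1)) *\<^sub>R
              (q i (T - 1) + (\<Sum>t\<in>visits T s i. q i t))"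
  shows "(real (T + N - 1) / real N) *\<^sub>R (\<Sum>i\<in>{1..N}. v i) =
           (\<Sum>i\<in>{1..N}. (real (T - 1) / real N - real (card (visits T s i))) *\<^sub>R v i)
           + ((\<Sum>t<T - 1. q (s t) t) + (\<Sum>i\<in>{1..N}. q i (T - 1)))"
proof -
  have v_eq: "(real (T + N - 1) / real N) *\<^sub>R v i
      = (real (T - 1) / real N - real (card (visits T s i))) *\<^sub>R v i
        + (q i (T - 1) + (\<Sum>t\<in>visits T s i. q i t))" for i
  proof -
    \<comment> \<open>\<open>T + N - 1\<close> counts all oracle responses used:
      \<open>T - 1\<close> sampled ones and \<open>N\<close> in the last step. The split isolates
      the weight error; the summand \<open>card + 1\<close> cancels the denominator of
      \<open>v i\<close>.\<close>
    have "real (T + N - 1) / real N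
        = (real (T - 1) / real N - real (card (visits T s i))) + (real (card (visits T s i)) + 1)"
      using assms(1,2) by (simp add: field_simps of_nat_diff)
    then have "(real (T + N - 1) / real N) *\<^sub>R v i
        = (real (T - 1) / real N - real (card (visits T s i))) *\<^sub>R v i
          + (real (card (visits T s i)) + 1) *\<^sub>R v i"
      by (metis scaleR_add_left)
    also have "(real (card (visits T s i)) + 1) *\<^sub>R v i = q i (T - 1) + (\<Sum>t\<in>visits T s i. q i t)"
      unfolding v by (simp add: add_nonneg_eq_0_iff)
    finally show ?thesis .
  qed
  show ?thesis
    unfolding scaleR_sum_right v_eq sum.distrib sum_over_visits[OF s] by (simp add: ac_simps)
qed

text \<open>Stated in a general normed space to serve both the vector residuals and the real
  costs.\<close>

lemma norm_visit_average_le: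
  fixes q :: "nat \<Rightarrow> 'a::real_normed_vector"
  assumes "\<And>t. norm (q t) \<le> B"
  shows "norm ((1 / (real (card (visits T s i)) + 1)) *\<^sub>R (q (T - 1) + (\<Sum>t\<in>visits T s i. q t))) \<le> B"
proof -
  have "norm (q (T - 1) + (\<Sum>t\<in>visits T s i. q t)) \<le> B + card (visits T s i) * B"
    by (intro norm_triangle_mono assms order_trans[OF norm_sum] sum_bounded_above)
  then have "norm (q (T - 1) + (\<Sum>t\<in>visits T s i. q t)) / (real (card (visits T s i)) + 1) \<le> B"
    by (simp add: divide_le_eq algebra_simps)
  then show ?thesis
    unfolding norm_scaleR by simp
qed

section \<open>The stochastic dual subgradient iteration\<close>

text \<open>\<open>r i\<close> and \<open>\<eta> i\<close> stand for the constraint residual and the cost of the oracle's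
  response in block \<open>i\<close>. Optimality of \<open>lstar\<close> enters only through its value \<open>D\<close>, which bounds the
  dual function from above and the Lagrangian at \<open>lstar\<close> from below.\<close>

locale dual_subgradient =
  fixes N T :: nat
    and r :: "nat \<Rightarrow> real ^ 'm \<Rightarrow> real ^ 'm"
    and \<eta> :: "nat \<Rightarrow> real ^ 'm \<Rightarrow> real"
    and G H D \<Lambda> a :: real
    and lstar :: "real ^ 'm"
  assumes N: "N \<ge> 1" and T: "T \<ge> 1"
    and norm_r_le: "\<And>i l. i \<in> {1..N} \<Longrightarrow> 0 \<le> l \<Longrightarrow> norm (r i l) \<le> G"
    and abs_\<eta>_le: "\<And>i l. i \<in> {1..N} \<Longrightarrow> 0 \<le> l \<Longrightarrow> \<bar>\<eta> i l\<bar> \<le> H"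
    and dual_le: "\<And>l. 0 \<le> l \<Longrightarrow> mean {1..N} (\<lambda>i. \<eta> i l + l \<bullet> r i l) \<le> D"
    and le_lagrangian: "\<And>l. 0 \<le> l \<Longrightarrow> D \<le> mean {1..N} (\<lambda>i. \<eta> i l + lstar \<bullet> r i l)"
    and lstar_nonneg: "0 \<le> lstar"
    and G: "G > 0" and \<Lambda>: "\<Lambda> > 0"
    and stepsize: "a = \<Lambda> / (G * sqrt (real T))"
begin

section \<open>Iterates and sampled directions\<close>

definition step :: "(nat \<Rightarrow> nat) \<Rightarrow> nat \<Rightarrow> real ^ 'm \<Rightarrow> real ^ 'm" where
  "step s t l = (if t < T - 1 then r (s t) l else (1 / real N) *\<^sub>R (\<Sum>i\<in>{1..N}. r i l))"

primrec lam :: "(nat \<Rightarrow> nat) \<Rightarrow> nat \<Rightarrow> real ^ 'm" where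
  "lam s 0 = 0"
| "lam s (Suc t) = pos_proj (lam s t + a *\<^sub>R step s t (lam s t))"

abbreviation "\<Omega> \<equiv> {..<T - 1} \<rightarrow>\<^sub>E {1..N}"

abbreviation "g s t \<equiv> step s t (lam s t)"

text \<open>One operator for directions, costs and Lagrangian values. In mean the sampled and the
  full iterations agree (\<open>mean_observed\<close>), so the drift and cost estimates need no case
  split on \<open>t\<close>.\<close>

definition observed :: "(nat \<Rightarrow> real ^ 'm \<Rightarrow> real) \<Rightarrow> (nat \<Rightarrow> nat) \<Rightarrow> nat \<Rightarrow> real" where
  "observed f s t = (if t < T - 1 then f (s t) (lam s t) else mean {1..N} (\<lambda>i. f i (lam s t)))"

lemma a_pos: "a > 0"
  using G \<Lambda> T by (simp add: stepsize)

lemma H_nonneg: "H \<ge> 0"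
  using abs_\<eta>_le[of 1 0] N by (simp add: order_trans[OF abs_ge_zero])

lemma \<Omega>_finite: "finite \<Omega>" and \<Omega>_nonempty: "\<Omega> \<noteq> {}"
  using N by (auto simp: finite_PiE PiE_eq_empty_iff)

lemma lam_nonneg: "0 \<le> lam s t"
  by (cases t) (simp_all add: pos_proj_nonneg)

text \<open>Adaptedness of the iterates: this is what makes the sample at \<open>t\<close> fresh
  relative to \<open>lam s t\<close>. The bound \<open>u < T - 1\<close> reflects that full steps
  draw no sample.\<close>

lemma lam_cong: "(\<And>u. u < t \<Longrightarrow> u < T - 1 \<Longrightarrow> s u = s' u) \<Longrightarrow> lam s t = lam s' t"
  by (induction t) (simp_all add: step_def)

lemma norm_g_le:
  assumes "s \<in> \<Omega>"
  shows "norm (g s t) \<le> G"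
proof (cases "t < T - 1")
  case True
  then show ?thesis
    using assms by (auto simp: step_def PiE_iff lam_nonneg intro!: norm_r_le)
next
  case False
  have "norm (\<Sum>i\<in>{1..N}. r i (lam s t)) \<le> of_nat (card {1..N}) * G"
    by (intro order_trans[OF norm_sum] sum_bounded_above norm_r_le lam_nonneg)
  then show ?thesis
    using N False by (simp add: step_def divide_simps mult.commute)
qed

lemma inner_g: "g s t \<bullet> y = observed (\<lambda>i l. r i l \<bullet> y) s t"
  by (simp add: step_def observed_def mean_def inner_sum_left divide_inverse mult.commute)

text \<open>Unbiasedness: \<open>lam s t\<close> ignores coordinate \<open>t\<close> of the path, so
  that coordinate can be resampled; a full step already is the block average.\<close>

lemma mean_observed: "mean \<Omega> (\<lambda>s. observed f s t) = mean \<Omega> (\<lambda>s. mean {1..N} (\<lambda>i. f i (lam s t)))"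
proof (cases "t < T - 1")
  case True
  have "mean \<Omega> (\<lambda>s. f (s t) (lam s t)) = mean \<Omega> (\<lambda>s. mean {1..N} (\<lambda>i. f i (lam s t)))"
  proof (rule mean_resample_coordinate[where F = "\<lambda>s i. f i (lam s t)"])
    fix s i j
    have "lam (s(t := i)) t = lam s t"
      by (rule lam_cong) simp
    then show "f j (lam (s(t := i)) t) = f j (lam s t)"
      by simp
  qed (use True N in auto)
  then show ?thesis
    using True by (simp add: observed_def)
qed (simp add: observed_def)

section \<open>Drift of the multipliers\<close>

text \<open>Nonexpansiveness toward \<open>y\<close>, then expansion of the square. The choice
  \<open>y = lstar\<close> bounds the multipliers, and \<open>y = 0\<close> controls the
  cost.\<close>

lemma drift:
  assumes "s \<in> \<Omega>" "0 \<le> y"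
  shows "(norm (lam s (Suc t) - y))\<^sup>2
    \<le> (norm (lam s t - y))\<^sup>2 + 2 * a * (g s t \<bullet> (lam s t - y)) + a\<^sup>2 * G\<^sup>2"
proof -
  have "(norm (lam s (Suc t) - y))\<^sup>2 \<le> (norm ((lam s t - y) + a *\<^sub>R g s t))\<^sup>2"
    using norm_pos_proj_diff_le[OF assms(2), of "lam s t + a *\<^sub>R g s t"]
    by (simp add: algebra_simps power_mono)
  also have "\<dots> = (norm (lam s t - y))\<^sup>2 + 2 * a * (g s t \<bullet> (lam s t - y)) + a\<^sup>2 * (norm (g s t))\<^sup>2"
    unfolding power2_norm_eq_inner
    by (simp add: inner_add_left inner_add_right inner_commute power2_eq_square)
  also have "a\<^sup>2 * (norm (g s t))\<^sup>2 \<le> a\<^sup>2 * G\<^sup>2"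
    by (intro mult_left_mono power_mono norm_g_le assms(1)) auto
  finally show ?thesis
    by simp
qed

text \<open>The supergradient inequality in mean. For the responses to the current multiplier l, the
  mean Lagrangian at l is at most \<open>D\<close> and the one at \<open>lstar\<close> is at least
  \<open>D\<close>; their difference is the averaged inner product.\<close>

lemma mean_inner_g: "mean \<Omega> (\<lambda>s. g s t \<bullet> (lam s t - lstar)) \<le> 0"
proof -
  have "mean \<Omega> (\<lambda>s. g s t \<bullet> (lam s t - lstar))
      = mean \<Omega> (\<lambda>s. observed (\<lambda>i l. r i l \<bullet> (l - lstar)) s t)"
    by (intro mean_cong) (simp add: inner_g observed_def)
  also have "\<dots> = mean \<Omega> (\<lambda>s. mean {1..N} (\<lambda>i. r i (lam s t) \<bullet> (lam s t - lstar)))"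
    by (rule mean_observed)
  also have "\<dots> \<le> mean \<Omega> (\<lambda>_. 0)"
  proof (rule mean_mono)
    fix s
    let ?l = "lam s t"
    have "mean {1..N} (\<lambda>i. \<eta> i ?l + ?l \<bullet> r i ?l)
        = mean {1..N} (\<lambda>i. (\<eta> i ?l + lstar \<bullet> r i ?l) + r i ?l \<bullet> (?l - lstar))"
      by (intro mean_cong) (simp add: inner_diff_left inner_diff_right inner_commute)
    then show "mean {1..N} (\<lambda>i. r i ?l \<bullet> (?l - lstar)) \<le> 0"
      using dual_le[OF lam_nonneg, of s t] le_lagrangian[OF lam_nonneg, of s t]
      by (simp add: mean_add)
  qed
  finally show ?thesis
    by (simp add: mean_def)
qed

lemma mean_square_dist: "mean \<Omega> (\<lambda>s. (norm (lam s t - lstar))\<^sup>2) \<le> (norm lstar)\<^sup>2 + t * (a\<^sup>2 * G\<^sup>2)"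
proof (induction t)
  case 0
  show ?case
    using mean_const[OF \<Omega>_finite \<Omega>_nonempty] by simp
next
  case (Suc t)
  have "mean \<Omega> (\<lambda>s. (norm (lam s (Suc t) - lstar))\<^sup>2)
      \<le> mean \<Omega> (\<lambda>s. (norm (lam s t - lstar))\<^sup>2 + 2 * a * (g s t \<bullet> (lam s t - lstar)) + a\<^sup>2 * G\<^sup>2)"
    by (intro mean_mono drift lstar_nonneg)
  also have "\<dots> = mean \<Omega> (\<lambda>s. (norm (lam s t - lstar))\<^sup>2)
      + 2 * a * mean \<Omega> (\<lambda>s. g s t \<bullet> (lam s t - lstar)) + a\<^sup>2 * G\<^sup>2"
    using mean_const[OF \<Omega>_finite \<Omega>_nonempty] by (simp only: mean_add mean_cmult)
  also have "\<dots> \<le> mean \<Omega> (\<lambda>s. (norm (lam s t - lstar))\<^sup>2) + a\<^sup>2 * G\<^sup>2"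
    using mean_inner_g[of t] a_pos by (simp add: mult_nonneg_nonpos)
  finally show ?case
    using Suc by (simp add: algebra_simps)
qed

text \<open>The stepsize makes the \<open>T\<close> quadratic errors add up to
  \<open>\<Lambda>\<^sup>2\<close>, so the root mean square distance to \<open>lstar\<close> is at
  most \<open>norm lstar + \<Lambda>\<close>; the triangle inequality adds the second
  \<open>norm lstar\<close>.\<close>

lemma mean_norm_lam:
  assumes "t \<le> T"
  shows "mean \<Omega> (\<lambda>s. norm (lam s t)) \<le> 2 * norm lstar + \<Lambda>"
proof -
  have "real t * (a\<^sup>2 * G\<^sup>2) \<le> real T * (a\<^sup>2 * G\<^sup>2)"
    using assms by (intro mult_right_mono) auto
  also have "\<dots> = \<Lambda>\<^sup>2"
    using G T by (simp add: stepsize power_mult_distrib power_divide)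
  finally have "mean \<Omega> (\<lambda>s. (norm (lam s t - lstar))\<^sup>2) \<le> (norm lstar)\<^sup>2 + \<Lambda>\<^sup>2"
    using mean_square_dist[of t] by linarith
  also have "\<dots> \<le> (norm lstar + \<Lambda>)\<^sup>2"
    using \<Lambda> by (simp add: power2_sum)
  finally have "sqrt (mean \<Omega> (\<lambda>s. (norm (lam s t - lstar))\<^sup>2)) \<le> norm lstar + \<Lambda>"
    using \<Lambda> by (simp add: real_le_lsqrt)
  then have "mean \<Omega> (\<lambda>s. norm (lam s t - lstar)) \<le> norm lstar + \<Lambda>"
    by (rule order_trans[OF mean_le_sqrt_mean_square])
  moreover have "mean \<Omega> (\<lambda>s. norm (lam s t)) \<le> mean \<Omega> (\<lambda>s. norm lstar + norm (lam s t - lstar))"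
    by (rule mean_mono) (rule norm_triangle_sub)
  ultimately show ?thesis
    unfolding mean_add mean_const[OF \<Omega>_finite \<Omega>_nonempty] by linarith
qed

section \<open>Constraint violation\<close>

text \<open>Projection only raises coordinates and the iteration starts at 0, so every unprojected
  partial sum stays below the iterate.\<close>

lemma sum_g_le_lam: "a *\<^sub>R (\<Sum>t<k. g s t) \<le> lam s k"
proof (induction k)
  case (Suc k)
  have "a *\<^sub>R (\<Sum>t<Suc k. g s t) \<le> lam s k + a *\<^sub>R g s k"
    using Suc by (simp add: scaleR_add_right add_right_mono)
  also have "\<dots> \<le> lam s (Suc k)"
    by (simp add: pos_proj_def less_eq_vec_def)
  finally show ?case .
qed simp

lemma pos_norm_sum_g: "pos_norm (\<Sum>t<k. g s t) \<le> norm (lam s k) / a"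
proof -
  have "a * pos_norm (\<Sum>t<k. g s t) = pos_norm (a *\<^sub>R (\<Sum>t<k. g s t))"
    using a_pos by (simp only: pos_norm_scaleR less_imp_le)
  also have "\<dots> \<le> norm (lam s k)"
    by (rule order_trans[OF pos_norm_mono[OF sum_g_le_lam] pos_norm_le_norm])
  finally have "a * pos_norm (\<Sum>t<k. g s t) \<le> norm (lam s k)" .
  then show ?thesis
    using a_pos by (simp add: field_simps)
qed

lemma mean_sum_visit_deviation:
  "mean \<Omega> (\<lambda>s. \<Sum>i\<in>{1..N}. \<bar>real (T - 1) / real N - card (visits T s i)\<bar>)
    \<le> sqrt (real (T - 1) * (real N - 1))"
  using mean_sum_count_deviation[of "{..<T - 1}" "{1..N}"] N by (simp add: visits_def)

text \<open>Replacing \<open>T - 1\<close> by \<open>T\<close> in the numerator and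
  \<open>T + N - 1\<close> by \<open>T\<close> in the denominator only enlarges the
  quotient.\<close>

lemma normalized_deviation:
  "sqrt (real (T - 1) * (real N - 1)) / real (T + N - 1) \<le> sqrt ((real N - 1) / real T)"
proof -
  have "sqrt (real (T - 1) * (real N - 1)) \<le> sqrt (real T * (real N - 1))"
    using N by (intro real_sqrt_le_mono mult_right_mono) auto
  also have "\<dots> = real T * sqrt ((real N - 1) / real T)"
  proof -
    have "real T * sqrt ((real N - 1) / real T) = sqrt ((real T)\<^sup>2 * ((real N - 1) / real T))"
      by (subst real_sqrt_mult) simp
    also have "(real T)\<^sup>2 * ((real N - 1) / real T) = real T * (real N - 1)"
      using T by (simp add: power2_eq_square)
    finally show ?thesis ..
  qed
  also have "\<dots> \<le> real (T + N - 1) * sqrt ((real N - 1) / real T)"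
    using N by (intro mult_right_mono) auto
  finally show ?thesis
    using N T by (simp add: pos_divide_le_eq mult.commute)
qed

lemma le_divide_normalization:
  "real (T + N - 1) * m \<le> x + y + z \<Longrightarrow>
    m \<le> x / real (T + N - 1) + y / real (T + N - 1) + z / real (T + N - 1)"
  unfolding add_divide_distrib[symmetric]
  using N T by (simp add: pos_le_divide_eq mult.commute[of m])

lemma divide_normalization_le: "x \<ge> 0 \<Longrightarrow> x / real (T + N - 1) \<le> x / real T"
  using N T by (intro divide_left_mono) auto

text \<open>The normalized violation splits into weight errors, the trajectory sum bounded by
  \<open>norm (lam s T) / a\<close>, and surplus copies of the last direction.\<close>

lemma mean_constraint_violation:
  assumes v: "\<And>s i. v s i = (1 / (real (card (visits T s i)) + 1)) *\<^sub>R
              (r i (lam s (T - 1)) + (\<Sum>t\<in>visits T s i. r i (lam s t)))"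
  shows "mean \<Omega> (\<lambda>s. pos_norm ((1 / real N) *\<^sub>R (\<Sum>i\<in>{1..N}. v s i)))
    \<le> G * sqrt ((real N - 1) / real T) + 2 * G * norm lstar / (\<Lambda> * sqrt (real T))
      + G / sqrt (real T) + real N * G / real T"
proof -
  define K where "K = real (T + N - 1)"
  define e where "e s i = real (T - 1) / real N - card (visits T s i)" for s i
  have K: "K > 0"
    using N T by (simp add: K_def)
  have bound: "K * pos_norm ((1 / real N) *\<^sub>R (\<Sum>i\<in>{1..N}. v s i))
      \<le> G * (\<Sum>i\<in>{1..N}. \<bar>e s i\<bar>) + (1 / a) * norm (lam s T) + (real N - 1) * G"
    if s: "s \<in> \<Omega>" for s
  proof -
    let ?n = "T - 1"
    have norm_v: "norm (v s i) \<le> G" if "i \<in> {1..N}" for i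
      unfolding v using that by (intro norm_visit_average_le norm_r_le lam_nonneg)
    \<comment> \<open>The last step contributes \<open>N\<close> residuals, that is \<open>N\<close>
      copies of its direction: one completes the trajectory sum and \<open>N - 1\<close> are
      surplus.\<close>
    have last: "(\<Sum>i\<in>{1..N}. r i (lam s ?n)) = g s ?n + (real N - 1) *\<^sub>R g s ?n"
    proof -
      have "g s ?n + (real N - 1) *\<^sub>R g s ?n = real N *\<^sub>R g s ?n"
        by (simp add: scaleR_left_diff_distrib)
      then show ?thesis
        using N by (simp add: step_def)
    qed
    have "{..<T} = insert ?n {..<?n}"
      using T by auto
    then have "(\<Sum>t<T. g s t) = (\<Sum>t<?n. r (s t) (lam s t)) + g s ?n"
      by (simp add: step_def)
    then have "K *\<^sub>R ((1 / real N) *\<^sub>R (\<Sum>i\<in>{1..N}. v s i))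
        = (\<Sum>i\<in>{1..N}. e s i *\<^sub>R v s i) + ((\<Sum>t<T. g s t) + (real N - 1) *\<^sub>R g s ?n)"
      using average_of_visit_averages[OF N T s v]
      unfolding last K_def e_def by (simp add: add.assoc)
    then have "K * pos_norm ((1 / real N) *\<^sub>R (\<Sum>i\<in>{1..N}. v s i))
        = pos_norm ((\<Sum>i\<in>{1..N}. e s i *\<^sub>R v s i) + ((\<Sum>t<T. g s t) + (real N - 1) *\<^sub>R g s ?n))"
      by (metis K less_imp_le pos_norm_scaleR)
    also have "\<dots> \<le> pos_norm (\<Sum>i\<in>{1..N}. e s i *\<^sub>R v s i)
          + (pos_norm (\<Sum>t<T. g s t) + pos_norm ((real N - 1) *\<^sub>R g s ?n))"
      by (rule order_trans[OF pos_norm_triangle add_left_mono[OF pos_norm_triangle]])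
    also have "pos_norm (\<Sum>i\<in>{1..N}. e s i *\<^sub>R v s i) \<le> (\<Sum>i\<in>{1..N}. \<bar>e s i\<bar> * G)"
      by (intro order_trans[OF pos_norm_le_norm] order_trans[OF norm_sum] sum_mono)
        (simp add: norm_v mult_left_mono)
    also have "pos_norm ((real N - 1) *\<^sub>R g s ?n) \<le> (real N - 1) * G"
      using N by (subst pos_norm_scaleR)
        (auto intro!: mult_left_mono order_trans[OF pos_norm_le_norm norm_g_le[OF s]])
    finally show ?thesis
      using pos_norm_sum_g[of s T] by (simp add: sum_distrib_left mult.commute)
  qed
  have "K * mean \<Omega> (\<lambda>s. pos_norm ((1 / real N) *\<^sub>R (\<Sum>i\<in>{1..N}. v s i)))
      \<le> mean \<Omega> (\<lambda>s. G * (\<Sum>i\<in>{1..N}. \<bar>e s i\<bar>) + (1 / a) * norm (lam s T) + (real N - 1) * G)"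
    unfolding mean_cmult[symmetric] by (rule mean_mono) (rule bound)
  also have "\<dots> = G * mean \<Omega> (\<lambda>s. \<Sum>i\<in>{1..N}. \<bar>e s i\<bar>) + (1 / a) * mean \<Omega> (\<lambda>s. norm (lam s T))
      + (real N - 1) * G"
    using mean_const[OF \<Omega>_finite \<Omega>_nonempty] by (simp only: mean_add mean_cmult)
  also have "\<dots> \<le> G * sqrt (real (T - 1) * (real N - 1)) + (1 / a) * (2 * norm lstar + \<Lambda>) + real N * G"
    using G a_pos mean_norm_lam[of T] mean_sum_visit_deviation
    by (intro add_mono mult_left_mono) (auto simp: e_def algebra_simps)
  finally have "mean \<Omega> (\<lambda>s. pos_norm ((1 / real N) *\<^sub>R (\<Sum>i\<in>{1..N}. v s i)))
      \<le> G * (sqrt (real (T - 1) * (real N - 1)) / K) + (1 / a) * (2 * norm lstar + \<Lambda>) / K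
        + real N * G / K"
    unfolding K_def times_divide_eq_right by (rule le_divide_normalization)
  also have "\<dots> \<le> G * sqrt ((real N - 1) / real T) + (1 / a) * (2 * norm lstar + \<Lambda>) / real T
      + real N * G / real T"
    using G a_pos \<Lambda> normalized_deviation unfolding K_def
    by (intro add_mono mult_left_mono divide_normalization_le) auto
  \<comment> \<open>Here 1 / a = G sqrt(T) / \<Lambda>, so the multiplier bound divided by
    \<open>T\<close> yields the two middle terms of the rate.\<close>
  also have "(1 / a) * (2 * norm lstar + \<Lambda>) / real T
      = 2 * G * norm lstar / (\<Lambda> * sqrt (real T)) + G / sqrt (real T)"
  proof -
    define q where "q = sqrt (real T)"
    have "q > 0" and T_eq: "real T = q * q"
      using T by (simp_all add: q_def)
    then show ?thesis
      using G \<Lambda> unfolding stepsize q_def[symmetric] unfolding T_eq by (simp add: field_simps)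
  qed
  finally show ?thesis
    by simp
qed

section \<open>Primal cost\<close>

text \<open>The drift inequality with \<open>y = 0\<close> telescopes from
  \<open>lam s 0 = 0\<close>; the final squared norm is nonnegative and is dropped.\<close>

lemma sum_mean_inner_g_lam: "- (\<Sum>t<k. mean \<Omega> (\<lambda>s. g s t \<bullet> lam s t)) \<le> real k * (a * G\<^sup>2 / 2)"
proof -
  have "mean \<Omega> (\<lambda>s. (norm (lam s k))\<^sup>2)
      \<le> 2 * a * (\<Sum>t<k. mean \<Omega> (\<lambda>s. g s t \<bullet> lam s t)) + real k * (a\<^sup>2 * G\<^sup>2)"
  proof (induction k)
    case 0
    show ?case
      by (simp add: mean_def)
  next
    case (Suc k)
    have "mean \<Omega> (\<lambda>s. (norm (lam s (Suc k)))\<^sup>2)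
        \<le> mean \<Omega> (\<lambda>s. (norm (lam s k))\<^sup>2 + 2 * a * (g s k \<bullet> lam s k) + a\<^sup>2 * G\<^sup>2)"
      by (intro mean_mono) (use drift[of _ 0] in simp)
    also have "\<dots> = mean \<Omega> (\<lambda>s. (norm (lam s k))\<^sup>2) + 2 * a * mean \<Omega> (\<lambda>s. g s k \<bullet> lam s k) + a\<^sup>2 * G\<^sup>2"
      using mean_const[OF \<Omega>_finite \<Omega>_nonempty] by (simp only: mean_add mean_cmult)
    finally show ?case
      using Suc by (simp add: algebra_simps)
  qed
  moreover have "0 \<le> mean \<Omega> (\<lambda>s. (norm (lam s k))\<^sup>2)"
    by (simp add: mean_def sum_nonneg)
  ultimately have "0 \<le> a * (2 * (\<Sum>t<k. mean \<Omega> (\<lambda>s. g s t \<bullet> lam s t)) + real k * (a * G\<^sup>2))"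
    by (simp add: algebra_simps power2_eq_square)
  then show ?thesis
    using a_pos by (simp add: zero_le_mult_iff)
qed

text \<open>Cost is Lagrangian minus multiplier times residual, and by unbiasedness the mean
  Lagrangian at the current multiplier is a dual value, at most \<open>D\<close>.\<close>

lemma mean_observed_cost:
  "mean \<Omega> (\<lambda>s. observed \<eta> s t) \<le> D - mean \<Omega> (\<lambda>s. g s t \<bullet> lam s t)"
proof -
  have "mean \<Omega> (\<lambda>s. observed \<eta> s t) + mean \<Omega> (\<lambda>s. g s t \<bullet> lam s t)
      = mean \<Omega> (\<lambda>s. observed (\<lambda>i l. \<eta> i l + l \<bullet> r i l) s t)"
    unfolding mean_add[symmetric]
    by (intro mean_cong, simp only: inner_g) (simp add: observed_def mean_add inner_commute)
  also have "\<dots> \<le> mean \<Omega> (\<lambda>_. D)"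
    unfolding mean_observed by (intro mean_mono dual_le lam_nonneg)
  also have "\<dots> = D"
    by (rule mean_const[OF \<Omega>_finite \<Omega>_nonempty])
  finally show ?thesis
    by simp
qed

text \<open>The surplus copies of the last step concern a single iteration, where nothing
  telescopes; Cauchy-Schwarz and the multiplier bound take over.\<close>

lemma mean_observed_cost_norm:
  assumes "t \<le> T"
  shows "mean \<Omega> (\<lambda>s. observed \<eta> s t) \<le> D + G * (2 * norm lstar + \<Lambda>)"
proof -
  have "mean \<Omega> (\<lambda>s. (- 1) * (g s t \<bullet> lam s t)) \<le> mean \<Omega> (\<lambda>s. G * norm (lam s t))"
  proof (rule mean_mono)
    fix s assume "s \<in> \<Omega>"
    have "(- 1) * (g s t \<bullet> lam s t) \<le> norm (g s t) * norm (lam s t)"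
      using Cauchy_Schwarz_ineq2[of "g s t" "lam s t"] by simp
    also have "\<dots> \<le> G * norm (lam s t)"
      by (intro mult_right_mono norm_g_le \<open>s \<in> \<Omega>\<close>) simp
    finally show "(- 1) * (g s t \<bullet> lam s t) \<le> G * norm (lam s t)" .
  qed
  also have "\<dots> \<le> G * (2 * norm lstar + \<Lambda>)"
    unfolding mean_cmult using G mean_norm_lam[OF assms] by simp
  finally show ?thesis
    using mean_observed_cost[of t] unfolding mean_cmult by simp
qed

lemma mean_cost:
  assumes w: "\<And>s i. w s i = (1 / (real (card (visits T s i)) + 1)) *\<^sub>R
              (\<eta> i (lam s (T - 1)) + (\<Sum>t\<in>visits T s i. \<eta> i (lam s t)))"
  shows "mean \<Omega> (\<lambda>s. (1 / real N) * (\<Sum>i\<in>{1..N}. w s i))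
    \<le> D + (H * sqrt ((real N - 1) / real T) + \<Lambda> * G / (2 * sqrt (real T))
            + real N * G * (2 * norm lstar + \<Lambda>) / real T)"
proof -
  define K where "K = real (T + N - 1)"
  define e where "e s i = real (T - 1) / real N - card (visits T s i)" for s i
  let ?n = "T - 1"
  have bound: "K * ((1 / real N) * (\<Sum>i\<in>{1..N}. w s i))
      \<le> H * (\<Sum>i\<in>{1..N}. \<bar>e s i\<bar>) + (\<Sum>t<T. observed \<eta> s t) + (real N - 1) * observed \<eta> s ?n"
    if s: "s \<in> \<Omega>" for s
  proof -
    have abs_w: "\<bar>w s i\<bar> \<le> H" if "i \<in> {1..N}" for i
      using norm_visit_average_le[of "\<lambda>t. \<eta> i (lam s t)" H] that
      by (simp add: w abs_\<eta>_le lam_nonneg)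
    have last: "(\<Sum>i\<in>{1..N}. \<eta> i (lam s ?n)) = observed \<eta> s ?n + (real N - 1) * observed \<eta> s ?n"
    proof -
      have "observed \<eta> s ?n + (real N - 1) * observed \<eta> s ?n = real N * observed \<eta> s ?n"
        by (simp add: left_diff_distrib)
      then show ?thesis
        using N by (simp add: observed_def mean_def)
    qed
    have "{..<T} = insert ?n {..<?n}"
      using T by auto
    then have "(\<Sum>t<T. observed \<eta> s t) = (\<Sum>t<?n. \<eta> (s t) (lam s t)) + observed \<eta> s ?n"
      by (simp add: observed_def)
    then have "K * ((1 / real N) * (\<Sum>i\<in>{1..N}. w s i))
        = (\<Sum>i\<in>{1..N}. e s i * w s i) + ((\<Sum>t<T. observed \<eta> s t) + (real N - 1) * observed \<eta> s ?n)"
      using average_of_visit_averages[OF N T s w]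
      unfolding last K_def e_def by (simp add: add.assoc)
    also have "(\<Sum>i\<in>{1..N}. e s i * w s i) \<le> (\<Sum>i\<in>{1..N}. \<bar>e s i\<bar> * H)"
    proof (rule sum_mono)
      fix i assume "i \<in> {1..N}"
      have "e s i * w s i \<le> \<bar>e s i\<bar> * \<bar>w s i\<bar>"
        by (metis abs_ge_self abs_mult)
      also have "\<dots> \<le> \<bar>e s i\<bar> * H"
        by (intro mult_left_mono abs_w \<open>i \<in> {1..N}\<close>) simp
      finally show "e s i * w s i \<le> \<bar>e s i\<bar> * H" .
    qed
    finally show ?thesis
      by (simp add: sum_distrib_left mult.commute)
  qed
  have "(\<Sum>t<T. mean \<Omega> (\<lambda>s. observed \<eta> s t)) \<le> (\<Sum>t<T. D - mean \<Omega> (\<lambda>s. g s t \<bullet> lam s t))"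
    by (intro sum_mono mean_observed_cost)
  also have "\<dots> \<le> T * D + T * (a * G\<^sup>2 / 2)"
    using sum_mean_inner_g_lam[of T] by (simp add: sum_subtractf)
  finally have costs: "(\<Sum>t<T. mean \<Omega> (\<lambda>s. observed \<eta> s t)) \<le> T * D + T * (a * G\<^sup>2 / 2)" .
  have "K * mean \<Omega> (\<lambda>s. (1 / real N) * (\<Sum>i\<in>{1..N}. w s i))
      \<le> mean \<Omega> (\<lambda>s. H * (\<Sum>i\<in>{1..N}. \<bar>e s i\<bar>) + (\<Sum>t<T. observed \<eta> s t)
                       + (real N - 1) * observed \<eta> s ?n)"
    unfolding mean_cmult[of \<Omega> K, symmetric] by (rule mean_mono) (rule bound)
  also have "\<dots> = H * mean \<Omega> (\<lambda>s. \<Sum>i\<in>{1..N}. \<bar>e s i\<bar>)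
      + (\<Sum>t<T. mean \<Omega> (\<lambda>s. observed \<eta> s t)) + (real N - 1) * mean \<Omega> (\<lambda>s. observed \<eta> s ?n)"
    by (simp only: mean_add mean_cmult mean_sum)
  also have "\<dots> \<le> H * sqrt (real (T - 1) * (real N - 1)) + (T * D + T * (a * G\<^sup>2 / 2))
      + (real N - 1) * (D + G * (2 * norm lstar + \<Lambda>))"
    using N H_nonneg mean_sum_visit_deviation
    by (intro add_mono mult_left_mono costs mean_observed_cost_norm) (auto simp: e_def)
  \<comment> \<open>The trajectory supplies \<open>T\<close> copies of \<open>D\<close> and the
    surplus \<open>N - 1\<close>, together exactly \<open>K\<close>; the factor \<open>N - 1\<close>
    of the other surplus term is rounded up to \<open>N\<close>.\<close>
  also have "\<dots> \<le> K * D + (H * sqrt (real (T - 1) * (real N - 1)) + T * (a * G\<^sup>2 / 2)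
      + real N * G * (2 * norm lstar + \<Lambda>))"
  proof -
    have K_eq: "K = real T + (real N - 1)"
      using N T by (simp add: K_def of_nat_diff)
    have "0 \<le> G * (2 * norm lstar + \<Lambda>)"
      using G \<Lambda> by simp
    then show ?thesis
      unfolding K_eq by (simp add: algebra_simps)
  qed
  \<comment> \<open>\<open>D\<close> may have either sign, so it is moved to the left before the
    denominator \<open>K\<close> is lowered to \<open>T\<close>.\<close>
  finally have "K * (mean \<Omega> (\<lambda>s. (1 / real N) * (\<Sum>i\<in>{1..N}. w s i)) - D)
      \<le> H * sqrt (real (T - 1) * (real N - 1)) + T * (a * G\<^sup>2 / 2)
        + real N * G * (2 * norm lstar + \<Lambda>)"
    unfolding right_diff_distrib by linarith
  from le_divide_normalization[OF this[unfolded K_def]]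
  have "mean \<Omega> (\<lambda>s. (1 / real N) * (\<Sum>i\<in>{1..N}. w s i))
      \<le> D + (H * (sqrt (real (T - 1) * (real N - 1)) / K) + T * (a * G\<^sup>2 / 2) / K
        + real N * G * (2 * norm lstar + \<Lambda>) / K)"
    unfolding K_def times_divide_eq_right by linarith
  also have "\<dots> \<le> D + (H * sqrt ((real N - 1) / real T) + T * (a * G\<^sup>2 / 2) / real T
      + real N * G * (2 * norm lstar + \<Lambda>) / real T)"
    using G a_pos \<Lambda> H_nonneg normalized_deviation unfolding K_def
    by (intro add_mono mult_left_mono divide_normalization_le order_refl) auto
  also have "T * (a * G\<^sup>2 / 2) / real T = \<Lambda> * G / (2 * sqrt (real T))"
    using G T by (simp add: stepsize power2_eq_square)
  finally show ?thesis .
qed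

end

section \<open>The separable problem\<close>

lemma ereal_real_eff_dom: "proper_fun h \<Longrightarrow> x \<in> eff_dom h \<Longrightarrow> ereal (real_of_ereal (h x)) = h x"
  by (auto simp: proper_fun_def eff_dom_def ereal_real)

lemma convex_on_real_of_ereal:
  assumes "proper_fun h" "ereal_convex h" "convex (eff_dom h)"
  shows "convex_on (eff_dom h) (\<lambda>x. real_of_ereal (h x))"
  unfolding convex_on_def
proof (intro conjI ballI allI impI)
  fix x y and u v :: real
  assume x: "x \<in> eff_dom h" and y: "y \<in> eff_dom h" and uv: "0 \<le> u" "0 \<le> v" "u + v = 1"
  have "u *\<^sub>R x + v *\<^sub>R y \<in> eff_dom h"
    using assms(3) x y uv by (rule convexD)
  moreover have "h (u *\<^sub>R x + v *\<^sub>R y) \<le> ereal u * h x + ereal v * h y"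
  proof -
    have "v \<in> {0..1}" and u: "u = 1 - v"
      using uv by auto
    then show ?thesis
      using assms(2) unfolding ereal_convex_def u by blast
  qed
  ultimately have "ereal (real_of_ereal (h (u *\<^sub>R x + v *\<^sub>R y)))
      \<le> ereal u * ereal (real_of_ereal (h x)) + ereal v * ereal (real_of_ereal (h y))"
    using assms(1) x y by (simp only: ereal_real_eff_dom)
  then show "real_of_ereal (h (u *\<^sub>R x + v *\<^sub>R y)) \<le> u * real_of_ereal (h x) + v * real_of_ereal (h y)"
    by simp
qed (rule assms(3))

text \<open>Jensen with equal weights; \<open>T - 1\<close> lies outside the visit set, so the last
  response counts as one additional point.\<close>

lemma convex_on_visit_average:
  assumes "convex_on C f" and q: "\<And>t. q t \<in> C"
  shows "f ((1 / (real (card (visits T s i)) + 1)) *\<^sub>R (q (T - 1) + (\<Sum>t\<in>visits T s i. q t)))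
    \<le> (1 / (real (card (visits T s i)) + 1)) *\<^sub>R (f (q (T - 1)) + (\<Sum>t\<in>visits T s i. f (q t)))"
proof -
  let ?V = "visits T s i" and ?c = "1 / (real (card (visits T s i)) + 1)"
  have V: "finite ?V" "T - 1 \<notin> ?V"
    by (simp_all add: visits_def)
  have "f (\<Sum>t\<in>insert (T - 1) ?V. ?c *\<^sub>R q t) \<le> (\<Sum>t\<in>insert (T - 1) ?V. ?c * f (q t))"
    by (rule convex_on_sum) (use assms V in \<open>simp_all add: add.commute\<close>)
  then show ?thesis
    unfolding scaleR_sum_right[symmetric] sum_distrib_left[symmetric] using V by simp
qed

lemma dual_iter_cong:
  "(\<And>t. t < T - 1 \<Longrightarrow> s t = s' t) \<Longrightarrow>
    dual_iter N A b xs T \<alpha> l0 s k = dual_iter N A b xs T \<alpha> l0 s' k"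
  by (induction k) (simp_all add: step_dir_def)

lemma primal_output_cong:
  assumes "\<And>t. t < T - 1 \<Longrightarrow> s t = s' t"
  shows "primal_output N A b xs T \<alpha> l0 s = primal_output N A b xs T \<alpha> l0 s'"
proof -
  have "visits T s = visits T s'"
    using assms by (auto simp: visits_def fun_eq_iff)
  moreover have "dual_iter N A b xs T \<alpha> l0 s = dual_iter N A b xs T \<alpha> l0 s'"
    using dual_iter_cong[of T s s', OF assms] by (intro ext)
  ultimately show ?thesis
    by (simp add: primal_output_def fun_eq_iff)
qed

lemma oracle_in_dom:
  "is_oracle N h A xs \<Longrightarrow> i \<in> {1..N} \<Longrightarrow> 0 \<le> l \<Longrightarrow> xs i l \<in> eff_dom (h i)"
  by (simp add: is_oracle_def is_arg_min_def)

lemma oracle_minimal: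
  assumes "is_oracle N h A xs" "i \<in> {1..N}" "0 \<le> l" "x \<in> eff_dom (h i)"
  shows "h i (xs i l) + ereal (l \<bullet> (A i *v xs i l)) \<le> h i x + ereal (l \<bullet> (A i *v x))"
  using assms by (auto simp: is_oracle_def is_arg_min_def not_less)

text \<open>The oracle response attains each infimum with a finite value, and
  \<open>l \<bullet> b\<close> is spread evenly over the \<open>N\<close> blocks.\<close>

lemma dual_fun_oracle:
  assumes "N \<ge> 1" and minimizing: "is_oracle N h A xs" and l: "0 \<le> l"
    and proper: "\<And>i. i \<in> {1..N} \<Longrightarrow> proper_fun (h i)"
  shows "dual_fun N h A b l
    = ereal (mean {1..N} (\<lambda>i. real_of_ereal (h i (xs i l)) + l \<bullet> (A i *v xs i l - b)))"
proof -
  have "(INF x\<in>eff_dom (h i). h i x + ereal (l \<bullet> (A i *v x)))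
      = ereal (real_of_ereal (h i (xs i l)) + l \<bullet> (A i *v xs i l))" if i: "i \<in> {1..N}" for i
  proof -
    have "(INF x\<in>eff_dom (h i). h i x + ereal (l \<bullet> (A i *v x)))
        = h i (xs i l) + ereal (l \<bullet> (A i *v xs i l))"
      by (intro antisym INF_greatest INF_lower oracle_in_dom[OF minimizing i l]
          oracle_minimal[OF minimizing i l])
    then show ?thesis
      using ereal_real_eff_dom[OF proper[OF i] oracle_in_dom[OF minimizing i l]]
      by (metis plus_ereal.simps(1))
  qed
  then have "dual_fun N h A b l
      = ereal (- (l \<bullet> b) + (1 / N) * (\<Sum>i\<in>{1..N}. real_of_ereal (h i (xs i l)) + l \<bullet> (A i *v xs i l)))"
    by (simp add: dual_fun_def)
  also have "- (l \<bullet> b) + (1 / N) * (\<Sum>i\<in>{1..N}. real_of_ereal (h i (xs i l)) + l \<bullet> (A i *v xs i l))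
      = mean {1..N} (\<lambda>i. real_of_ereal (h i (xs i l)) + l \<bullet> (A i *v xs i l - b))"
    using \<open>N \<ge> 1\<close>
    by (simp add: mean_def inner_diff_right sum.distrib sum_subtractf field_simps)
  finally show ?thesis .
qed

theorem proposition3p2:
  fixes N T :: nat
    and J :: "nat \<Rightarrow> 'd::finite set"
    and h :: "nat \<Rightarrow> real ^ 'd \<Rightarrow> ereal"
    and A :: "nat \<Rightarrow> real ^ 'd ^ 'm"
    and b lstar :: "real ^ 'm"
    and xs :: "nat \<Rightarrow> real ^ 'm \<Rightarrow> real ^ 'd"
    and G H \<Lambda> :: real
    and M :: "'w measure"
    and ix :: "nat \<Rightarrow> 'w \<Rightarrow> nat"
    and \<alpha> :: "nat \<Rightarrow> real"
    and xbar :: "'w \<Rightarrow> nat \<Rightarrow> real ^ 'd"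
  assumes "N \<ge> 1" and "T \<ge> 1"
    and "\<And>i. i \<in> {1..N} \<Longrightarrow> proper_fun (h i)"
    and "\<And>i. i \<in> {1..N} \<Longrightarrow> ereal_convex (h i)"
    and "\<And>i. i \<in> {1..N} \<Longrightarrow> lower_semicont (h i)"
    and "\<And>i. i \<in> {1..N} \<Longrightarrow> eff_dom (h i) \<subseteq> block_space (J i)"
    and "\<And>i. i \<in> {1..N} \<Longrightarrow> convex (eff_dom (h i))"
    and "\<And>i. i \<in> {1..N} \<Longrightarrow> compact (eff_dom (h i))"
    and "is_arg_max (dual_fun N h A b) (\<lambda>l. 0 \<le> l) lstar"
    and "dual_fun N h A b lstar = primal_value N h A b"
    and "ereal G = (SUP i\<in>{1..N}. SUP x\<in>eff_dom (h i). ereal (norm (A i *v x - b)))"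
    and "G > 0"
    and "ereal H = (SUP i\<in>{1..N}. SUP x\<in>eff_dom (h i). \<bar>h i x\<bar>)"
    and "is_oracle N h A xs"
    and "uniform_samples M N T ix"
    and "\<Lambda> > 0"
    and "\<alpha> = (\<lambda>_. \<Lambda> / (G * sqrt (real T)))"
    and "xbar = (\<lambda>\<omega>. primal_output N A b xs T \<alpha> 0 (\<lambda>t. ix t \<omega>))"
  shows "(\<integral>\<omega>. pos_norm ((1 / real N) *\<^sub>R (\<Sum>i\<in>{1..N}. A i *v xbar \<omega> i) - b) \<partial>M)
           \<le> G * sqrt ((real N - 1) / real T) + 2 * G * norm lstar / (\<Lambda> * sqrt (real T))
              + G / sqrt (real T) + real N * G / real T
       \<and> ereal (\<integral>\<omega>. (1 / real N) * (\<Sum>i\<in>{1..N}. real_of_ereal (h i (xbar \<omega> i))) \<partial>M)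
           \<le> dual_fun N h A b lstar
              + ereal (H * sqrt ((real N - 1) / real T) + \<Lambda> * G / (2 * sqrt (real T))
                       + real N * G * (2 * norm lstar + \<Lambda>) / real T)"
proof -
  note minimizing = \<open>is_oracle N h A xs\<close>
  have lstar: "0 \<le> lstar" and lstar_max: "\<And>l. 0 \<le> l \<Longrightarrow> dual_fun N h A b l \<le> dual_fun N h A b lstar"
    using \<open>is_arg_max _ _ lstar\<close> by (auto simp: is_arg_max_def not_less)
  define r where "r i l = A i *v xs i l - b" for i l
  define \<eta> where "\<eta> i l = real_of_ereal (h i (xs i l))" for i l
  define D where "D = mean {1..N} (\<lambda>i. \<eta> i lstar + lstar \<bullet> r i lstar)"
  define a where "a = \<Lambda> / (G * sqrt (real T))"
  have dual: "dual_fun N h A b l = ereal (mean {1..N} (\<lambda>i. \<eta> i l + l \<bullet> r i l))" if "0 \<le> l" for l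
    unfolding r_def \<eta>_def using assms(1,3) minimizing that by (intro dual_fun_oracle) auto
  have h_eq: "ereal (\<eta> i l) = h i (xs i l)" if "i \<in> {1..N}" "0 \<le> l" for i l
    unfolding \<eta>_def using assms(3) oracle_in_dom[OF minimizing] that by (intro ereal_real_eff_dom) auto
  interpret dual_subgradient N T r \<eta> G H D \<Lambda> a lstar
  proof
    fix i and l :: "real ^ 'm" assume i: "i \<in> {1..N}" and l: "0 \<le> l"
    have "ereal (norm (r i l)) \<le> ereal G"
      unfolding \<open>ereal G = _\<close> r_def
      by (rule SUP_upper2[OF i]) (rule SUP_upper[OF oracle_in_dom[OF minimizing i l]])
    then show "norm (r i l) \<le> G"
      by simp
    have "\<bar>ereal (\<eta> i l)\<bar> \<le> ereal H"
      unfolding \<open>ereal H = _\<close> h_eq[OF i l]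
      by (rule SUP_upper2[OF i]) (rule SUP_upper[OF oracle_in_dom[OF minimizing i l]])
    then show "\<bar>\<eta> i l\<bar> \<le> H"
      by simp
  next
    fix l :: "real ^ 'm" assume l: "0 \<le> l"
    show "mean {1..N} (\<lambda>i. \<eta> i l + l \<bullet> r i l) \<le> D"
      using lstar_max[OF l] by (simp add: dual l lstar D_def)
    \<comment> \<open>At \<open>lstar\<close> the oracle minimizes every block Lagrangian, so the
      responses to another multiplier cannot give a smaller value.\<close>
    show "D \<le> mean {1..N} (\<lambda>i. \<eta> i l + lstar \<bullet> r i l)"
      unfolding D_def
    proof (rule mean_mono)
      fix i assume i: "i \<in> {1..N}"
      have "ereal (\<eta> i lstar + lstar \<bullet> (A i *v xs i lstar)) \<le> ereal (\<eta> i l + lstar \<bullet> (A i *v xs i l))"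
        using oracle_minimal[OF minimizing i lstar oracle_in_dom[OF minimizing i l]]
        by (simp add: h_eq[OF i l, symmetric] h_eq[OF i lstar, symmetric])
      then show "\<eta> i lstar + lstar \<bullet> r i lstar \<le> \<eta> i l + lstar \<bullet> r i l"
        by (simp add: r_def inner_diff_right)
    qed
  qed (use assms(1,2,12,16) lstar in \<open>simp_all add: a_def\<close>)
  have \<alpha>: "\<alpha> t = a" for t
    by (simp add: assms(17) a_def)
  have lam_eq: "dual_iter N A b xs T \<alpha> 0 s t = lam s t" for s t
  proof (induction t)
    case (Suc t)
    have "step_dir N A b xs T s t l = step s t l" for l
      using N by (simp add: step_dir_def step_def r_def sum_subtractf scaleR_diff_right
          sum_constant_scaleR del: sum_constant)
    then show ?case
      using Suc by (simp add: \<alpha>)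
  qed simp
  define x where "x s = primal_output N A b xs T \<alpha> 0 s" for s
  have x_cong: "x s = x s'" if "\<And>t. t < T - 1 \<Longrightarrow> s t = s' t" for s s'
    unfolding x_def using that by (rule primal_output_cong)
  have x_eq: "x s i = (1 / (real (card (visits T s i)) + 1)) *\<^sub>R
      (xs i (lam s (T - 1)) + (\<Sum>t\<in>visits T s i. xs i (lam s t)))" for s i
    by (simp add: x_def primal_output_def lam_eq)
  define v where "v s i = (1 / (real (card (visits T s i)) + 1)) *\<^sub>R
      (r i (lam s (T - 1)) + (\<Sum>t\<in>visits T s i. r i (lam s t)))" for s i
  define w where "w s i = (1 / (real (card (visits T s i)) + 1)) *\<^sub>R
      (\<eta> i (lam s (T - 1)) + (\<Sum>t\<in>visits T s i. \<eta> i (lam s t)))" for s i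
  have "A i *v x s i - b = v s i" for s i
  proof -
    \<comment> \<open>Scaled by the number \<open>c\<close> of averaged responses, the claim is
      linearity of \<open>A i\<close> together with \<open>c\<close> copies of
      \<open>b\<close>.\<close>
    define c where "c = real (card (visits T s i)) + 1"
    have "c > 0"
      by (simp add: c_def add_nonneg_pos)
    have "c *\<^sub>R v s i = A i *v (c *\<^sub>R x s i) - c *\<^sub>R b"
      using \<open>c > 0\<close> unfolding v_def x_eq c_def[symmetric]
      by (simp add: r_def c_def matrix_vector_right_distrib sum_subtractf sum_constant_scaleR
          scaleR_left_distrib linear_sum[OF matrix_vector_mul_linear] del: sum_constant)
    then have "c *\<^sub>R v s i = c *\<^sub>R (A i *v x s i - b)"
      by (simp add: scaleR_diff_right matrix_vector_mult_scaleR)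
    then show ?thesis
      using \<open>c > 0\<close> by simp
  qed
  then have v_eq: "v s i = A i *v x s i - b" for s i
    by simp
  have residual: "(1 / real N) *\<^sub>R (\<Sum>i\<in>{1..N}. A i *v x s i) - b = (1 / real N) *\<^sub>R (\<Sum>i\<in>{1..N}. v s i)" for s
    using N by (simp add: sum_subtractf scaleR_diff_right sum_constant_scaleR v_eq del: sum_constant)
  \<comment> \<open>Convexity enters only here: the cost of the averaged point is at most the
    average \<open>w\<close> of the oracle costs.\<close>
  have cost: "real_of_ereal (h i (x s i)) \<le> w s i" if i: "i \<in> {1..N}" for s i
    unfolding x_eq w_def \<eta>_def
    by (rule convex_on_visit_average[OF convex_on_real_of_ereal])
      (use assms(3,4,7) i oracle_in_dom[OF minimizing i lam_nonneg] in auto)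
  have xbar: "xbar \<omega> = x (\<lambda>t. ix t \<omega>)" for \<omega>
    by (simp add: assms(18) x_def)
  have "(\<integral>\<omega>. pos_norm ((1 / real N) *\<^sub>R (\<Sum>i\<in>{1..N}. A i *v xbar \<omega> i) - b) \<partial>M)
      = mean \<Omega> (\<lambda>s. pos_norm ((1 / real N) *\<^sub>R (\<Sum>i\<in>{1..N}. A i *v x s i) - b))"
    unfolding xbar
    by (rule integral_uniform_samples[OF assms(15) N, where f = "\<lambda>s. pos_norm ((1 / real N) *\<^sub>R (\<Sum>i\<in>{1..N}. A i *v x s i) - b)"])
      (use x_cong in metis)
  also have "\<dots> \<le> G * sqrt ((real N - 1) / real T) + 2 * G * norm lstar / (\<Lambda> * sqrt (real T))
              + G / sqrt (real T) + real N * G / real T"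
    unfolding residual by (rule mean_constraint_violation) (rule v_def)
  finally have violation: "(\<integral>\<omega>. pos_norm ((1 / real N) *\<^sub>R (\<Sum>i\<in>{1..N}. A i *v xbar \<omega> i) - b) \<partial>M)
      \<le> \<dots>" .
  have "(\<integral>\<omega>. (1 / real N) * (\<Sum>i\<in>{1..N}. real_of_ereal (h i (xbar \<omega> i))) \<partial>M)
      = mean \<Omega> (\<lambda>s. (1 / real N) * (\<Sum>i\<in>{1..N}. real_of_ereal (h i (x s i))))"
    unfolding xbar
    by (rule integral_uniform_samples[OF assms(15) N, where f = "\<lambda>s. (1 / real N) * (\<Sum>i\<in>{1..N}. real_of_ereal (h i (x s i)))"])
      (use x_cong in metis)
  also have "\<dots> \<le> mean \<Omega> (\<lambda>s. (1 / real N) * (\<Sum>i\<in>{1..N}. w s i))"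
    by (intro mean_mono mult_left_mono sum_mono cost) auto
  also have "\<dots> \<le> D + (H * sqrt ((real N - 1) / real T) + \<Lambda> * G / (2 * sqrt (real T))
                       + real N * G * (2 * norm lstar + \<Lambda>) / real T)"
    by (rule mean_cost) (rule w_def)
  finally show ?thesis
    using violation by (simp add: dual lstar D_def)
qed

end
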